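(* Let $G$ be the Lévy exponent of a mixed-exponential jump-diffusion process, let $h<H$ be real numbers, and let $\alpha>0$, $\rho>0$. Assume that the root assumption $\mathrm{(R}_a)$ described in the context holds for $a=\alpha$ and $a=\alpha+\rho$. Let $S=m+n+2$ and, for real $a$, let $$v(a)=\left(1,\ a,\ \tfrac{1}{\eta_1-a},\dots,\tfrac1{\eta_m-a},\ \tfrac1{\theta_1+a},\dots,\tfrac1{\theta_n+a}\right)^{\top}\in\mathbb{R}^S.$$ Let $M$ be the $S\times S$ matrix with successive columns $v(\beta_{1,\alpha}),\dots,v(\beta_{m+1,\alpha}),v(-\gamma_{1,\alpha+\rho}),\dots,v(-\gamma_{n+1,\alpha+\rho})$, let $N$ be the $S\times S$ matrix with successive columns $v(-\gamma_{1,\alpha}),\dots,v(-\gamma_{n+1,\alpha}),v(\beta_{1,\alpha+\rho}),\dots,v(\beta_{m+1,\alpha+\rho})$, and let $Z_\beta$, $Z_\gamma$ be the $S\times S$ diagonal matrices with diagonal entries, respectively, $$\big(\underbrace{0,\dots,0}_{n+1},e^{\beta_{1,\alpha+\rho}(h-H)},\dots,e^{\beta_{m+1,\alpha+\rho}(h-H)}\big)\quad\text{and}\quad \big(\underbrace{0,\dots,0}_{m+1},e^{\gamma_{1,\alpha+\rho}(h-H)},\dots,e^{\gamma_{n+1,\alpha+\rho}(h-H)}\big).$$ Then the $2S\times2S$ matrix $$B=\begin{pmatrix} M & NZ_\beta\\ MZ_\gamma & N\end{pmatrix}$$ is invertible.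
   Context: Mixed-exponential jump-diffusion (MEJD) process: $X_t=X_0+\mu t+\sigma W_t+\sum_{i=1}^{N_t}Y_i$, $t\ge0$, where $\mu\in\mathbb{R}$, $\sigma\ge0$, $W$ is a standard Brownian motion, $N$ is a homogeneous Poisson process with rate $\lambda$, and $Y_1,Y_2,\dots$ are i.i.d. with probability density function $$f_Y(y)=p_u\sum_{i=1}^m p_i\eta_ie^{-\eta_iy}\mathbf 1_{\{y\ge0\}}+q_d\sum_{j=1}^n q_j\theta_je^{\theta_jy}\mathbf 1_{\{y<0\}},$$ with $W$, $N$, $(Y_i)$ mutually independent. Here $p_u,q_d\ge0$, $p_u+q_d=1$, $p_i,q_j\in\mathbb{R}$ (possibly negative, but such that $f_Y$ is a probability density), $\sum_{i=1}^m p_i=1$, $\sum_{j=1}^n q_j=1$, $0<\eta_1<\dots<\eta_m$ and $0<\theta_1<\dots<\theta_n$. The Lévy exponent is $$G(\zeta)=\mu\zeta+\frac{\sigma^2}{2}\zeta^2+\lambda\left(p_u\sum_{i=1}^m\frac{p_i\eta_i}{\eta_i-\zeta}+q_d\sum_{j=1}^n\frac{q_j\theta_j}{\theta_j+\zeta}-1\right),$$ so that $\mathbb{E}[e^{\zeta (X_t-X_0)}]=e^{tG(\zeta)}$ for $\zeta\in(-\theta_1,\eta_1)$; $G$ is also regarded as a rational function on $\mathbb{R}$ minus its poles. Root assumption $\mathrm{(R}_a)$, for $a>0$: the equation $G(\zeta)=a$ has exactly $m+n+2$ distinct real solutions, namely $m+1$ positive ones $\beta_{1,a},\dots,\beta_{m+1,a}$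 and $n+1$ negative ones, written $-\gamma_{1,a},\dots,-\gamma_{n+1,a}$ with $\gamma_{j,a}>0$, satisfying $$0<\beta_{1,a}<\eta_1<\beta_{2,a}<\dots<\eta_m<\beta_{m+1,a}<\infty,\qquad 0<\gamma_{1,a}<\theta_1<\gamma_{2,a}<\dots<\theta_n<\gamma_{n+1,a}<\infty.$$ *)

theory Defs
  imports "HOL-Probability.Probability" "Jordan_Normal_Form.Matrix"
begin

text \<open>
  Parameters of a mixed-exponential jump-diffusion process. The finite families
  \<open>p\<^sub>i, \<eta>\<^sub>i\<close> and \<open>q\<^sub>j, \<theta>\<^sub>j\<close> are functions on \<open>nat\<close>, of which only the values at
  \<open>1, \<dots>, num_up\<close> and \<open>1, \<dots>, num_down\<close> are used.
\<close>

record mejd =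
  num_up :: nat             \<comment> \<open>\<open>m\<close>\<close>
  num_down :: nat           \<comment> \<open>\<open>n\<close>\<close>
  drift :: real             \<comment> \<open>\<open>\<mu>\<close>\<close>
  vol :: real               \<comment> \<open>\<open>\<sigma>\<close>\<close>
  jump_rate :: real         \<comment> \<open>\<open>\<lambda>\<close>\<close>
  prob_up :: real           \<comment> \<open>\<open>p\<^sub>u\<close>\<close>
  prob_down :: real         \<comment> \<open>\<open>q\<^sub>d\<close>\<close>
  wt_up :: "nat \<Rightarrow> real"   \<comment> \<open>\<open>p\<^sub>i\<close>\<close>
  wt_down :: "nat \<Rightarrow> real" \<comment> \<open>\<open>q\<^sub>j\<close>\<close>
  \<eta> :: "nat \<Rightarrow> real"
  \<theta> :: "nat \<Rightarrow> real"

definition jump_density :: "mejd \<Rightarrow> real \<Rightarrow> real" where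
  "jump_density P y =
     prob_up P * (\<Sum>i = 1..num_up P. wt_up P i * \<eta> P i * exp (- \<eta> P i * y)) * indicator {0..} y
   + prob_down P * (\<Sum>j = 1..num_down P. wt_down P j * \<theta> P j * exp (\<theta> P j * y)) * indicator {..<0} y"

text \<open>
  The mixing weights may be negative, so that the jump density is a probability density has to
  be required separately. That the weights sum to \<open>1\<close> forces \<open>num_up\<close> and \<open>num_down\<close> to be positive.
\<close>

definition is_mejd :: "mejd \<Rightarrow> bool" where
  "is_mejd P \<longleftrightarrow>
     0 \<le> vol P \<and> 0 < jump_rate P \<and>
     0 \<le> prob_up P \<and> 0 \<le> prob_down P \<and> prob_up P + prob_down P = 1 \<and>
     (\<Sum>i = 1..num_up P. wt_up P i) = 1 \<and> (\<Sum>j = 1..num_down P. wt_down P j) = 1 \<and>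
     (\<forall>i\<in>{1..num_up P}. 0 < \<eta> P i) \<and> strict_mono_on {1..num_up P} (\<eta> P) \<and>
     (\<forall>j\<in>{1..num_down P}. 0 < \<theta> P j) \<and> strict_mono_on {1..num_down P} (\<theta> P) \<and>
     (\<forall>y. 0 \<le> jump_density P y) \<and>
     prob_space (density lborel (\<lambda>y. ennreal (jump_density P y)))"

definition levy_exponent :: "mejd \<Rightarrow> real \<Rightarrow> real" where
  "levy_exponent P \<zeta> =
     drift P * \<zeta> + (vol P)\<^sup>2 / 2 * \<zeta>\<^sup>2
   + jump_rate P *
      (prob_up P * (\<Sum>i = 1..num_up P. wt_up P i * \<eta> P i / (\<eta> P i - \<zeta>))
       + prob_down P * (\<Sum>j = 1..num_down P. wt_down P j * \<theta> P j / (\<theta> P j + \<zeta>)) - 1)"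

text \<open>
  Since \<open>x / 0 = 0\<close>, \<^const>\<open>levy_exponent\<close> also has a value at its poles, which must be excluded
  explicitly. At a point \<open>\<eta>\<^sub>i\<close> or \<open>-\<theta>\<^sub>j\<close> that is not a pole because the corresponding coefficient
  vanishes, the same convention makes that summand contribute \<open>0\<close>, so the value agrees with that
  of the reduced rational function.
\<close>

definition levy_poles :: "mejd \<Rightarrow> real set" where
  "levy_poles P =
     {\<eta> P i | i. i \<in> {1..num_up P} \<and> prob_up P * wt_up P i \<noteq> 0}
   \<union> {- \<theta> P j | j. j \<in> {1..num_down P} \<and> prob_down P * wt_down P j \<noteq> 0}"

text \<open>
  \<open>root_assumption P a \<beta> \<gamma>\<close> states the root assumption at level \<open>a\<close>, with \<open>\<beta> 1, \<dots>, \<beta> (m + 1)\<close> the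
  positive and \<open>- \<gamma> 1, \<dots>, - \<gamma> (n + 1)\<close> the negative solutions. The interlacing makes these
  \<open>m + n + 2\<close> numbers distinct.
\<close>

definition root_assumption ::
    "mejd \<Rightarrow> real \<Rightarrow> (nat \<Rightarrow> real) \<Rightarrow> (nat \<Rightarrow> real) \<Rightarrow> bool" where
  "root_assumption P a \<beta> \<gamma> \<longleftrightarrow>
     {\<zeta>. \<zeta> \<notin> levy_poles P \<and> levy_exponent P \<zeta> = a} =
       \<beta> ` {1..num_up P + 1} \<union> (\<lambda>j. - \<gamma> j) ` {1..num_down P + 1} \<and>
     0 < \<beta> 1 \<and> (\<forall>i\<in>{1..num_up P}. \<beta> i < \<eta> P i \<and> \<eta> P i < \<beta> (i + 1)) \<and>
     0 < \<gamma> 1 \<and> (\<forall>j\<in>{1..num_down P}. \<gamma> j < \<theta> P j \<and> \<theta> P j < \<gamma> (j + 1))"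

definition dim_S :: "mejd \<Rightarrow> nat" where
  "dim_S P = num_up P + num_down P + 2"

definition v_vec :: "mejd \<Rightarrow> real \<Rightarrow> real Matrix.vec" where
  "v_vec P a = vec_of_list
     ([1, a] @ map (\<lambda>i. 1 / (\<eta> P i - a)) [1..<num_up P + 1]
             @ map (\<lambda>j. 1 / (\<theta> P j + a)) [1..<num_down P + 1])"

text \<open>
  In the following, \<open>\<beta>\<close>, \<open>\<gamma>\<close> are the roots at level \<open>\<alpha>\<close> and \<open>\<beta>'\<close>, \<open>\<gamma>'\<close> those at level \<open>\<alpha> + \<rho>\<close>.
\<close>

definition M_mat :: "mejd \<Rightarrow> (nat \<Rightarrow> real) \<Rightarrow> (nat \<Rightarrow> real) \<Rightarrow> real Matrix.mat" where
  "M_mat P \<beta> \<gamma>' = mat_of_cols (dim_S P)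
     (map (\<lambda>i. v_vec P (\<beta> i)) [1..<num_up P + 2] @ map (\<lambda>j. v_vec P (- \<gamma>' j)) [1..<num_down P + 2])"

definition N_mat :: "mejd \<Rightarrow> (nat \<Rightarrow> real) \<Rightarrow> (nat \<Rightarrow> real) \<Rightarrow> real Matrix.mat" where
  "N_mat P \<gamma> \<beta>' = mat_of_cols (dim_S P)
     (map (\<lambda>j. v_vec P (- \<gamma> j)) [1..<num_down P + 2] @ map (\<lambda>i. v_vec P (\<beta>' i)) [1..<num_up P + 2])"

definition Z_beta :: "mejd \<Rightarrow> real \<Rightarrow> real \<Rightarrow> (nat \<Rightarrow> real) \<Rightarrow> real Matrix.mat" where
  "Z_beta P h H \<beta>' = mat_diag (dim_S P)
     (nth (replicate (num_down P + 1) 0 @ map (\<lambda>i. exp (\<beta>' i * (h - H))) [1..<num_up P + 2]))"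

definition Z_gamma :: "mejd \<Rightarrow> real \<Rightarrow> real \<Rightarrow> (nat \<Rightarrow> real) \<Rightarrow> real Matrix.mat" where
  "Z_gamma P h H \<gamma>' = mat_diag (dim_S P)
     (nth (replicate (num_up P + 1) 0 @ map (\<lambda>j. exp (\<gamma>' j * (h - H))) [1..<num_down P + 2]))"

definition B_mat :: "mejd \<Rightarrow> real \<Rightarrow> real \<Rightarrow> (nat \<Rightarrow> real) \<Rightarrow> (nat \<Rightarrow> real) \<Rightarrow>
    (nat \<Rightarrow> real) \<Rightarrow> (nat \<Rightarrow> real) \<Rightarrow> real Matrix.mat" where
  "B_mat P h H \<beta> \<gamma> \<beta>' \<gamma>' =
     (let M = M_mat P \<beta> \<gamma>'; N = N_mat P \<gamma> \<beta>'
      in four_block_mat M (N * Z_beta P h H \<beta>') (M * Z_gamma P h H \<gamma>') N)"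

end

theory Submission
  imports Defs "HOL-Computational_Algebra.Polynomial" "Jordan_Normal_Form.Determinant"
begin

text \<open>
  The idea is to show that \<open>B\<close> has no nonzero left null vector. Write such a vector as a pair
  \<open>(c, d)\<close> and put \<open>C(z) = v(z) \<bullet> c\<close>, \<open>D(z) = v(z) \<bullet> d\<close>. These are rational functions with
  denominator \<open>Q(z) = \<Prod>(\<eta>\<^sub>i - z) \<Prod>(\<theta>\<^sub>j + z)\<close>, and \<open>p = C Q\<close>, \<open>r = D Q\<close> are polynomials of degree
  less than \<open>S\<close> that determine \<open>c\<close> and \<open>d\<close>. With \<open>\<beta>, \<gamma>\<close> the roots at level \<open>\<alpha>\<close> and \<open>\<beta>', \<gamma>'\<close>
  those at level \<open>\<alpha> + \<rho>\<close>, the \<open>2S\<close> columns of \<open>B\<close> say that \<open>p\<close> vanishes at every \<open>\<beta>\<^sub>k\<close>, that \<open>r\<close>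
  vanishes at every \<open>-\<gamma>\<^sub>j\<close>, and, the exponential factors being at most \<open>1\<close>, that
  \<open>\<bar>p\<bar> \<le> \<bar>r\<bar>\<close> at every \<open>-\<gamma>'\<^sub>j\<close> and \<open>\<bar>r\<bar> \<le> \<bar>p\<bar>\<close> at every \<open>\<beta>'\<^sub>k\<close> (\<open>B_mat_left_kernel\<close>).

  The contradiction comes from one inequality (\<open>weighted_sum_less\<close>). Let \<open>\<delta>\<^sub>k\<close>, \<open>\<epsilon>\<^sub>j\<close> be the absolute
  values of the weights in the Lagrange formula that expresses \<open>f(0)\<close>, for \<open>deg f < S\<close>, by the values
  of \<open>f\<close> at the nodes \<open>\<beta>'\<^sub>k\<close>, \<open>-\<gamma>'\<^sub>j\<close>. If \<open>p \<noteq> 0\<close> has degree less than \<open>S\<close> and vanishes at every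
  \<open>\<beta>\<^sub>k\<close>, then \<open>\<Sum> \<delta>\<^sub>k \<bar>p(\<beta>'\<^sub>k)\<bar> < \<Sum> \<epsilon>\<^sub>j \<bar>p(-\<gamma>'\<^sub>j)\<bar>\<close>. Indeed
  \<open>p(z) = a(z) \<Sum> \<kappa>\<^sub>j g\<^sub>j(z)\<close> with \<open>a(z) = \<Prod>(\<beta>\<^sub>i - z)\<close>, \<open>g\<^sub>j(z) = \<Prod>\<^bsub>l \<noteq> j\<^esub> (\<gamma>'\<^sub>l + z)\<close>. Replacing each
  \<open>\<kappa>\<^sub>j\<close> by \<open>\<bar>\<kappa>\<^sub>j\<bar>\<close> gives a polynomial \<open>p\<^sup>*\<close> with \<open>p\<^sup>*(0) > 0\<close>, with \<open>\<bar>p\<^sup>*\<bar> = \<bar>p\<bar>\<close> at the \<open>-\<gamma>'\<^sub>j\<close>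
  and \<open>\<bar>p\<^sup>*\<bar> \<ge> \<bar>p\<bar>\<close> at the \<open>\<beta>'\<^sub>k\<close>. In the Lagrange formula for \<open>p\<^sup>*(0)\<close> the terms at \<open>-\<gamma>'\<^sub>j\<close> are
  nonnegative and those at \<open>\<beta>'\<^sub>k\<close> are nonpositive, because \<open>a(\<beta>'\<^sub>k)\<close> and
  \<open>\<Prod>\<^bsub>i \<noteq> k\<^esub> (\<beta>'\<^sub>i - \<beta>'\<^sub>k)\<close> have opposite signs. Under \<open>z \<mapsto> -z\<close> the same inequality gives
  \<open>\<Sum> \<epsilon>\<^sub>j \<bar>r(-\<gamma>'\<^sub>j)\<bar> < \<Sum> \<delta>\<^sub>k \<bar>r(\<beta>'\<^sub>k)\<bar>\<close> for \<open>r \<noteq> 0\<close>, and the four comparisons close up to a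
  cycle that forces \<open>p = r = 0\<close> (\<open>null_pair_trivial\<close>).

  The opposite signs (\<open>root_product_signs\<close>) are where the Levy exponent enters. The numerator
  \<open>(G - \<alpha>) Q\<close> has degree at most \<open>S\<close> and the \<open>S\<close> roots \<open>\<beta>\<^sub>k\<close>, \<open>-\<gamma>\<^sub>j\<close>, so it equals
  \<open>c \<Prod>(\<beta>\<^sub>k - z) \<Prod>(\<gamma>\<^sub>j + z)\<close>; since \<open>G(0) = 0 < \<alpha>\<close>, the constant \<open>c\<close> is negative. At \<open>\<beta>'\<^sub>k\<close> the
  numerator equals \<open>\<rho> Q(\<beta>'\<^sub>k)\<close>, so that \<open>a(\<beta>'\<^sub>k)\<close> has the sign opposite to \<open>\<Prod>(\<eta>\<^sub>i - \<beta>'\<^sub>k)\<close>, and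
  interlacing shows that the latter has the sign of \<open>\<Prod>\<^bsub>i \<noteq> k\<^esub> (\<beta>'\<^sub>i - \<beta>'\<^sub>k)\<close>.
\<close>

hide_const (open) Module.module.smult
unbundle no inner_syntax
unbundle no vec_syntax

section \<open>Lagrange interpolation\<close>

lemma poly_eq_0_of_roots:
  fixes p :: "real poly"
  assumes "finite I" "inj_on t I" "degree p < card I" "\<And>i. i \<in> I \<Longrightarrow> poly p (t i) = 0"
  shows "p = 0"
proof (rule ccontr)
  assume "p \<noteq> 0"
  have "card I = card (t ` I)"
    using assms(2) by (simp add: card_image)
  also have "\<dots> \<le> card {x. poly p x = 0}"
    using assms(4) \<open>p \<noteq> 0\<close> by (intro card_mono) (auto simp: poly_roots_finite)
  also have "\<dots> \<le> degree p"
    using \<open>p \<noteq> 0\<close> by (rule card_poly_roots_bound)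
  finally show False using assms(3) by simp
qed

lemma degree_prod_linear_le:
  fixes b :: "'i \<Rightarrow> 'a::comm_ring_1"
  assumes "finite I"
  shows "degree (\<Prod>i\<in>I. [:b i, c:]) \<le> card I"
proof -
  have "degree (\<Prod>i\<in>I. [:b i, c:]) \<le> (\<Sum>i\<in>I. degree [:b i, c:])"
    using degree_prod_sum_le[OF assms, of "\<lambda>i. [:b i, c:]"] by (simp add: o_def)
  also have "\<dots> \<le> (\<Sum>i\<in>I. 1)" by (intro sum_mono) simp
  finally show ?thesis by simp
qed

lemma lagrange_interpolation:
  fixes p :: "real poly"
  assumes fin: "finite I" and inj: "inj_on t I" and deg: "degree p < card I"
  shows "poly p z = (\<Sum>i\<in>I. poly p (t i) * (\<Prod>l\<in>I-{i}. (t l - z) / (t l - t i)))"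
proof -
  define L where "L i = (\<Prod>l\<in>I-{i}. smult (1 / (t l - t i)) [:t l, -1:])" for i
  have L: "poly (L i) w = (\<Prod>l\<in>I-{i}. (t l - w) / (t l - t i))" for i w
    by (simp add: L_def poly_prod diff_divide_distrib)
  have degL: "degree (L i) \<le> card I - 1" if "i \<in> I" for i
  proof -
    have "degree (L i) \<le> (\<Sum>l\<in>I-{i}. degree (smult (1 / (t l - t i)) [:t l, -1:]))"
      unfolding L_def
      using degree_prod_sum_le[of "I-{i}" "\<lambda>l. smult (1 / (t l - t i)) [:t l, -1:]"] fin
      by (simp add: o_def)
    also have "\<dots> \<le> (\<Sum>l\<in>I-{i}. 1)"
      by (intro sum_mono) simp
    finally show ?thesis using that fin by simp
  qed
  define q where "q = (\<Sum>i\<in>I. smult (poly p (t i)) (L i))"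
  have "poly (L i) (t k) = (if i = k then 1 else 0)" if "i \<in> I" "k \<in> I" for i k
  proof (cases "i = k")
    case True
    then have "t l \<noteq> t i" if "l \<in> I - {i}" for l
      using that \<open>i \<in> I\<close> inj by (auto dest: inj_onD)
    then show ?thesis using True by (simp add: L)
  next
    case False
    then show ?thesis using that fin by (auto simp: L)
  qed
  then have node: "poly q (t k) = poly p (t k)" if "k \<in> I" for k
    using that fin by (simp add: q_def poly_sum if_distrib[of "(*) _"] cong: if_cong)
  have "degree q \<le> card I - 1"
    unfolding q_def using degL
    by (intro degree_sum_le fin) (meson degree_smult_le order_trans)
  then have "degree (p - q) < card I"
    using deg by (intro degree_diff_less) linarith+
  then have "p - q = 0"
    using node by (intro poly_eq_0_of_roots[OF fin inj]) auto
  then have "poly p z = poly q z" by simp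
  then show ?thesis by (simp add: q_def poly_sum L)
qed

text \<open>
  The case of nodes \<open>x\<^sub>k > 0\<close> and \<open>-y\<^sub>j < 0\<close>, with the basis polynomials written in the positive
  quantities \<open>x\<^sub>k\<close> and \<open>y\<^sub>j\<close>.
\<close>

lemma lagrange_interpolation_signed:
  fixes p :: "real poly"
  assumes fin: "finite K" "finite J" and inj: "inj_on x K" "inj_on y J"
    and pos: "\<And>k. k \<in> K \<Longrightarrow> 0 < x k" "\<And>j. j \<in> J \<Longrightarrow> 0 < y j"
    and deg: "degree p < card K + card J"
  shows "poly p z =
      (\<Sum>k\<in>K. poly p (x k) * ((\<Prod>i\<in>K-{k}. (x i - z) / (x i - x k)) * (\<Prod>j\<in>J. (y j + z) / (y j + x k))))
    + (\<Sum>j\<in>J. poly p (- y j) * ((\<Prod>i\<in>K. (x i - z) / (x i + y j)) * (\<Prod>l\<in>J-{j}. (y l + z) / (y l - y j))))"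
proof -
  \<comment> \<open>The nodes are indexed by the disjoint sum \<open>K <+> J\<close>.\<close>
  define t where "t = case_sum x (\<lambda>j. - y j)"
  have tl: "t (Inl k) = x k" "t (Inr j) = - y j" for k j by (simp_all add: t_def)
  have neg: "(- y j - z) / (- y j - w) = (y j + z) / (y j + w)" for j w
  proof -
    have "- y j - z = - (y j + z)" "- y j - w = - (y j + w)" by simp_all
    then show ?thesis by (simp only: minus_divide_divide)
  qed
  have neg': "(- y l - z) / (y j - y l) = (y l + z) / (y l - y j)" for j l
    using neg[of l "- y j"] by simp
  have ne: "x k \<noteq> - y j" if "k \<in> K" "j \<in> J" for k j
    using pos(1)[OF that(1)] pos(2)[OF that(2)] by linarith
  have "inj_on t (K <+> J)"
    using inj ne ne[THEN not_sym]
    by (intro inj_onI) (elim PlusE; simp add: tl inj_on_eq_iff)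
  moreover have "finite (K <+> J)" "degree p < card (K <+> J)"
    using fin deg by (simp_all add: card_Plus)
  ultimately have "poly p z = (\<Sum>i\<in>K <+> J. poly p (t i) * (\<Prod>l\<in>(K <+> J)-{i}. (t l - z) / (t l - t i)))"
    by (intro lagrange_interpolation)
  moreover have "(K <+> J) - {Inl k} = (K - {k}) <+> J" "(K <+> J) - {Inr j} = K <+> (J - {j})" for k j
    by auto
  ultimately show ?thesis
    using fin by (simp add: sum.Plus prod.Plus tl neg neg')
qed

lemma poly_eq_prod_of_roots:
  fixes p :: "real poly"
  assumes fin: "finite K" "finite J" and inj: "inj_on x K" "inj_on y J"
    and pos: "\<And>k. k \<in> K \<Longrightarrow> 0 < x k" "\<And>j. j \<in> J \<Longrightarrow> 0 < y j"
    and deg: "degree p \<le> card K + card J"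
    and root: "\<And>k. k \<in> K \<Longrightarrow> poly p (x k) = 0" "\<And>j. j \<in> J \<Longrightarrow> poly p (- y j) = 0"
    and ne: "0 < card K + card J"
  shows "poly p z = (-1) ^ card K * coeff p (card K + card J) * ((\<Prod>k\<in>K. x k - z) * (\<Prod>j\<in>J. y j + z))"
proof -
  define A where "A = (\<Prod>k\<in>K. [:x k, -1:]) * (\<Prod>j\<in>J. [:y j, 1:])"
  define c where "c = (-1) ^ card K * coeff p (card K + card J)"
  have deg_A: "degree A = card K + card J"
    using fin by (simp add: A_def degree_mult_eq degree_prod_eq_sum_degree)
  have lead: "coeff A (card K + card J) = (-1) ^ card K"
    using lead_coeff_mult[of "\<Prod>k\<in>K. [:x k, -1:]" "\<Prod>j\<in>J. [:y j, 1:]"] deg_A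
    by (simp add: A_def[symmetric] lead_coeff_prod)
  have "degree (p - smult c A) \<le> card K + card J"
    using deg deg_A by (intro degree_diff_le) auto
  moreover have "coeff (p - smult c A) (card K + card J) = 0"
    by (simp add: lead c_def mult.assoc[symmetric] power_mult_distrib[symmetric])
  ultimately have "degree (p - smult c A) < card K + card J"
    using ne by (metis coeff_0_degree_minus_1 degree_0 diff_less le_neq_implies_less leading_coeff_0_iff zero_less_one)
  moreover have "poly A (x k) = 0" if "k \<in> K" for k
    using that fin by (auto simp: A_def poly_prod)
  moreover have "poly A (- y j) = 0" if "j \<in> J" for j
    using that fin by (auto simp: A_def poly_prod)
  ultimately have "poly (p - smult c A) z = 0"
    using root by (subst lagrange_interpolation_signed[OF fin inj pos]) auto
  then show ?thesis by (simp add: A_def c_def poly_prod)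
qed

section \<open>The weighted comparison\<close>

text \<open>
  For the nodes \<open>x\<^sub>i\<close> (\<open>i \<in> K\<close>) and \<open>-y\<^sub>j\<close> (\<open>j \<in> J\<close>), with all \<open>x\<^sub>i, y\<^sub>j > 0\<close>, this is the absolute value
  at \<open>0\<close> of the Lagrange basis polynomial of the node \<open>x\<^sub>k\<close>. Exchanging \<open>(K, x)\<close> and \<open>(J, y)\<close> gives
  the one of \<open>-y\<^sub>k\<close>.
\<close>

definition lag_weight :: "nat set \<Rightarrow> (nat \<Rightarrow> real) \<Rightarrow> nat set \<Rightarrow> (nat \<Rightarrow> real) \<Rightarrow> nat \<Rightarrow> real" where
  "lag_weight K x J y k = (\<Prod>i\<in>K-{k}. x i / \<bar>x i - x k\<bar>) * (\<Prod>j\<in>J. y j / (y j + x k))"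

lemma lag_weight_nonneg:
  assumes "\<And>i. i \<in> K \<Longrightarrow> 0 < x i" "\<And>j. j \<in> J \<Longrightarrow> 0 < y j" "k \<in> K"
  shows "0 \<le> lag_weight K x J y k"
  unfolding lag_weight_def using assms
  by (intro mult_nonneg_nonneg prod_nonneg) (auto simp: less_imp_le add_pos_pos)

text \<open>
  Here \<open>x\<close> are the prescribed zeros of \<open>p\<close>, while \<open>x'\<close> and \<open>-y'\<close> are the interpolation nodes. The
  sign hypothesis makes the contributions of the nodes \<open>x'\<close> to the auxiliary value \<open>p\<^sup>*(0)\<close> nonpositive.
\<close>

lemma weighted_sum_less:
  fixes p :: "real poly"
  assumes fin: "finite K" "finite J"
    and inj: "inj_on x K" "inj_on x' K" "inj_on y' J"
    and pos: "\<And>k. k \<in> K \<Longrightarrow> 0 < x k" "\<And>k. k \<in> K \<Longrightarrow> 0 < x' k" "\<And>j. j \<in> J \<Longrightarrow> 0 < y' j"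
    and sgn: "\<And>k. k \<in> K \<Longrightarrow> (\<Prod>i\<in>K. x i - x' k) * (\<Prod>i\<in>K-{k}. x' i - x' k) < 0"
    and deg: "degree p < card K + card J"
    and root: "\<And>k. k \<in> K \<Longrightarrow> poly p (x k) = 0"
    and nz: "p \<noteq> 0"
  shows "(\<Sum>k\<in>K. lag_weight K x' J y' k * \<bar>poly p (x' k)\<bar>)
       < (\<Sum>j\<in>J. lag_weight J y' K x' j * \<bar>poly p (- y' j)\<bar>)"
proof -
  define a where "a z = (\<Prod>i\<in>K. x i - z)" for z
  define g where "g j z = (\<Prod>l\<in>J-{j}. y' l + z)" for j z
  define \<kappa> where "\<kappa> j = poly p (- y' j) / (a (- y' j) * g j (- y' j))" for j
  have p_eq: "poly p z = a z * (\<Sum>j\<in>J. \<kappa> j * g j z)" for z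
    using lagrange_interpolation_signed[OF fin inj(1,3) pos(1,3) deg, of z] root
    by (simp add: \<kappa>_def a_def g_def prod_dividef sum_distrib_left mult_ac)
  \<comment> \<open>The auxiliary polynomial \<open>p\<^sup>*\<close>, obtained from \<open>p\<close> by taking absolute values of the \<open>\<kappa> j\<close>.\<close>
  define ps where "ps = (\<Prod>i\<in>K. [:x i, -1:]) * (\<Sum>j\<in>J. smult \<bar>\<kappa> j\<bar> (\<Prod>l\<in>J-{j}. [:y' l, 1:]))"
  have ps_eq: "poly ps z = a z * (\<Sum>j\<in>J. \<bar>\<kappa> j\<bar> * g j z)" for z
    by (simp add: ps_def a_def g_def poly_prod poly_sum)
  have J_ne: "J \<noteq> {}"
    using p_eq nz by (auto simp: poly_eq_poly_eq_iff[symmetric] fun_eq_iff)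
  have deg_ps: "degree ps < card K + card J"
  proof -
    have "degree (\<Sum>j\<in>J. smult \<bar>\<kappa> j\<bar> (\<Prod>l\<in>J-{j}. [:y' l, 1:])) \<le> card J - 1"
    proof (intro degree_sum_le fin)
      fix j assume "j \<in> J"
      then show "degree (smult \<bar>\<kappa> j\<bar> (\<Prod>l\<in>J-{j}. [:y' l, 1:])) \<le> card J - 1"
        using degree_prod_linear_le[of "J-{j}" y' 1] fin
        by (metis card_Diff_singleton degree_smult_le finite_Diff order_trans)
    qed
    moreover have "degree (\<Prod>i\<in>K. [:x i, -1:]) \<le> card K"
      using fin by (intro degree_prod_linear_le)
    moreover have "0 < card J" using J_ne fin by (simp add: card_gt_0_iff)
    ultimately show ?thesis
      unfolding ps_def using degree_mult_le[of "\<Prod>i\<in>K. [:x i, -1:]"]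
      by (metis (no_types, lifting) add_le_less_mono diff_less le_less_trans less_one)
  qed
  have a_pos: "0 < a z" if "z \<le> 0" for z
    unfolding a_def using pos(1) that by (intro prod_pos) (smt (verit))
  have g_pos: "0 < g j z" if "0 \<le> z" for j z
    unfolding g_def using pos(3) that by (intro prod_pos) (auto intro: add_pos_nonneg)
  have g_ne: "g j (- y' j) \<noteq> 0" if "j \<in> J" for j
    using that inj(3) fin by (auto simp: g_def inj_on_def)
  have g_0: "g l (- y' j) = 0" if "j \<in> J" "l \<noteq> j" for l j
    using that fin by (auto simp: g_def)
  have "0 < poly ps 0"
  proof -
    obtain j where j: "j \<in> J" "\<kappa> j \<noteq> 0"
    proof (rule ccontr)
      assume "\<not> thesis"
      then have "\<kappa> j = 0" if "j \<in> J" for j using that \<open>\<And>j. j \<in> J \<Longrightarrow> \<kappa> j \<noteq> 0 \<Longrightarrow> thesis\<close> by blast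
      then have "poly p z = 0" for z using p_eq by simp
      then show False using nz poly_all_0_iff_0 by blast
    qed
    have "0 < (\<Sum>j\<in>J. \<bar>\<kappa> j\<bar> * g j 0)"
      using fin j g_pos[of 0] by (intro sum_pos2[of _ j]) (auto simp: less_imp_le)
    then show ?thesis using a_pos[of 0] by (simp add: ps_eq)
  qed
  also have "poly ps 0 =
      (\<Sum>k\<in>K. poly ps (x' k) * ((\<Prod>i\<in>K-{k}. x' i / (x' i - x' k)) * (\<Prod>j\<in>J. y' j / (y' j + x' k))))
    + (\<Sum>j\<in>J. poly ps (- y' j) * ((\<Prod>i\<in>K. x' i / (x' i + y' j)) * (\<Prod>l\<in>J-{j}. y' l / (y' l - y' j))))"
    using lagrange_interpolation_signed[OF fin inj(2,3) pos(2,3) deg_ps, of 0] by simp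
  also have "\<dots> \<le> (\<Sum>k\<in>K. - (lag_weight K x' J y' k * \<bar>poly p (x' k)\<bar>))
    + (\<Sum>j\<in>J. lag_weight J y' K x' j * \<bar>poly p (- y' j)\<bar>)"
  proof (intro add_mono sum_mono)
    fix k assume k: "k \<in> K"
    define b where "b = (\<Prod>i\<in>K-{k}. x' i - x' k)"
    define s where "s = (\<Sum>j\<in>J. \<bar>\<kappa> j\<bar> * g j (x' k))"
    define w where "w = (\<Prod>i\<in>K-{k}. x' i) * (\<Prod>j\<in>J. y' j / (y' j + x' k))"
    have ab: "a (x' k) * b < 0" using sgn[OF k] by (simp add: a_def b_def)
    have w: "0 \<le> w" unfolding w_def using pos k
      by (intro mult_nonneg_nonneg prod_nonneg) (auto simp: less_imp_le add_pos_pos)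
    have "\<bar>\<Sum>j\<in>J. \<kappa> j * g j (x' k)\<bar> \<le> (\<Sum>j\<in>J. \<bar>\<kappa> j * g j (x' k)\<bar>)"
      by (rule sum_abs)
    also have "\<dots> = s"
      using g_pos[of "x' k"] pos(2)[OF k] by (simp add: s_def abs_mult less_imp_le)
    finally have "\<bar>poly p (x' k)\<bar> \<le> \<bar>a (x' k)\<bar> * s"
      by (simp add: p_eq abs_mult mult_left_mono)
    then have "w / \<bar>b\<bar> * \<bar>poly p (x' k)\<bar> \<le> w / \<bar>b\<bar> * (\<bar>a (x' k)\<bar> * s)"
      using w by (intro mult_left_mono) auto
    moreover have "lag_weight K x' J y' k = w / \<bar>b\<bar>"
      by (simp add: lag_weight_def w_def b_def prod_dividef abs_prod)
    ultimately have "lag_weight K x' J y' k * \<bar>poly p (x' k)\<bar> \<le> w / \<bar>b\<bar> * (\<bar>a (x' k)\<bar> * s)"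
      by simp
    also have "\<dots> = - (poly ps (x' k) * (w / b))"
      using ab by (auto simp: ps_eq s_def abs_if mult_less_0_iff)
    finally show "poly ps (x' k) * ((\<Prod>i\<in>K-{k}. x' i / (x' i - x' k)) * (\<Prod>j\<in>J. y' j / (y' j + x' k)))
        \<le> - (lag_weight K x' J y' k * \<bar>poly p (x' k)\<bar>)"
      by (simp add: w_def b_def prod_dividef mult_ac)
  next
    fix j assume j: "j \<in> J"
    have sum_single: "(\<Sum>l\<in>J. f l * g l (- y' j)) = f j * g j (- y' j)" for f
      using j fin g_0[OF j] by (subst sum.remove[of _ j]) auto
    define u where "u = g j (- y' j)"
    define w where "w = (\<Prod>l\<in>J-{j}. y' l) * (\<Prod>i\<in>K. x' i / (x' i + y' j))"
    have a: "0 < a (- y' j)" using a_pos pos(3)[OF j] by simp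
    have u: "u \<noteq> 0" using g_ne[OF j] by (simp add: u_def)
    have "poly ps (- y' j) = a (- y' j) * (\<bar>\<kappa> j\<bar> * u)"
      by (simp add: ps_eq sum_single u_def)
    moreover have "\<bar>poly p (- y' j)\<bar> = a (- y' j) * (\<bar>\<kappa> j\<bar> * \<bar>u\<bar>)"
      using a by (simp add: p_eq sum_single u_def abs_mult)
    moreover have "lag_weight J y' K x' j = w / \<bar>u\<bar>"
      by (simp add: lag_weight_def w_def u_def g_def prod_dividef abs_prod)
    moreover have "(\<Prod>i\<in>K. x' i / (x' i + y' j)) * (\<Prod>l\<in>J-{j}. y' l / (y' l - y' j)) = w / u"
      by (simp add: w_def u_def g_def prod_dividef mult_ac)
    ultimately show "poly ps (- y' j) * ((\<Prod>i\<in>K. x' i / (x' i + y' j)) * (\<Prod>l\<in>J-{j}. y' l / (y' l - y' j)))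
        \<le> lag_weight J y' K x' j * \<bar>poly p (- y' j)\<bar>"
      using u by simp
  qed
  finally show ?thesis by (simp add: sum_negf)
qed

text \<open>
  For \<open>p \<noteq> 0\<close> and \<open>r \<noteq> 0\<close> the comparison for \<open>p\<close>, its mirror image for \<open>r\<close> and the two pointwise bounds
  would form a cycle of inequalities, two of them strict. If only one of \<open>p, r\<close> is nonzero, its strict
  inequality already contradicts the bounds.
\<close>

lemma null_pair_trivial:
  fixes p r :: "real poly" and K J :: "nat set"
  assumes fin: "finite K" "finite J"
    and inj: "inj_on x K" "inj_on x' K" "inj_on y J" "inj_on y' J"
    and pos: "\<And>k. k \<in> K \<Longrightarrow> 0 < x k" "\<And>k. k \<in> K \<Longrightarrow> 0 < x' k"
             "\<And>j. j \<in> J \<Longrightarrow> 0 < y j" "\<And>j. j \<in> J \<Longrightarrow> 0 < y' j"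
    and sgn_x: "\<And>k. k \<in> K \<Longrightarrow> (\<Prod>i\<in>K. x i - x' k) * (\<Prod>i\<in>K-{k}. x' i - x' k) < 0"
    and sgn_y: "\<And>j. j \<in> J \<Longrightarrow> (\<Prod>i\<in>J. y i - y' j) * (\<Prod>i\<in>J-{j}. y' i - y' j) < 0"
    and deg: "degree p < card K + card J" "degree r < card K + card J"
    and p_root: "\<And>k. k \<in> K \<Longrightarrow> poly p (x k) = 0"
    and r_root: "\<And>j. j \<in> J \<Longrightarrow> poly r (- y j) = 0"
    and p_le: "\<And>j. j \<in> J \<Longrightarrow> \<bar>poly p (- y' j)\<bar> \<le> \<bar>poly r (- y' j)\<bar>"
    and r_le: "\<And>k. k \<in> K \<Longrightarrow> \<bar>poly r (x' k)\<bar> \<le> \<bar>poly p (x' k)\<bar>"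
  shows "p = 0 \<and> r = 0"
proof -
  define d where "d = lag_weight K x' J y'"
  define b where "b = lag_weight J y' K x'"
  have p_less: "(\<Sum>k\<in>K. d k * \<bar>poly p (x' k)\<bar>) < (\<Sum>j\<in>J. b j * \<bar>poly p (- y' j)\<bar>)" if "p \<noteq> 0"
    unfolding d_def b_def
    by (rule weighted_sum_less[OF fin inj(1,2,4) pos(1,2,4) sgn_x deg(1) p_root that])
  define r' where "r' = pcompose r [:0, -1:]"
  have r': "poly r' z = poly r (- z)" for z by (simp add: r'_def poly_pcompose)
  have "degree r' = degree r" by (simp add: r'_def degree_pcompose)
  then have deg': "degree r' < card J + card K" using deg(2) by simp
  have r_less: "(\<Sum>j\<in>J. b j * \<bar>poly r (- y' j)\<bar>) < (\<Sum>k\<in>K. d k * \<bar>poly r (x' k)\<bar>)" if "r \<noteq> 0"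
  proof -
    have "r' \<noteq> 0" using that by (simp add: r'_def pcompose_eq_0_iff)
    from weighted_sum_less[OF fin(2,1) inj(3,4,2) pos(3,4,2) sgn_y deg' _ this]
    show ?thesis using r_root by (simp add: r' d_def b_def)
  qed
  have p_mono: "(\<Sum>j\<in>J. b j * \<bar>poly p (- y' j)\<bar>) \<le> (\<Sum>j\<in>J. b j * \<bar>poly r (- y' j)\<bar>)"
    unfolding b_def using p_le pos by (intro sum_mono mult_left_mono lag_weight_nonneg) auto
  have r_mono: "(\<Sum>k\<in>K. d k * \<bar>poly r (x' k)\<bar>) \<le> (\<Sum>k\<in>K. d k * \<bar>poly p (x' k)\<bar>)"
    unfolding d_def using r_le pos by (intro sum_mono mult_left_mono lag_weight_nonneg) auto
  have "p = 0 \<or> r = 0"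
    using p_less r_less p_mono r_mono by fastforce
  then show ?thesis
    using p_less r_less p_mono r_mono by (cases "p = 0"; cases "r = 0") auto
qed

section \<open>Interlacing sequences\<close>

lemma interlacing_less:
  fixes x e :: "nat \<Rightarrow> real"
  assumes il: "\<And>i. i \<in> {1..m} \<Longrightarrow> x i < e i \<and> e i < x (i + 1)"
    and "1 \<le> i" "i < j" "j \<le> m + 1"
  shows "x i < x j"
  using \<open>i < j\<close> \<open>j \<le> m + 1\<close>
proof (induction j)
  case (Suc j)
  have "x j < x (Suc j)" using il[of j] Suc.prems \<open>1 \<le> i\<close> by force
  with Suc show ?case by (cases "i = j") auto
qed simp

text \<open>
  Pair \<open>x\<^sub>i - x\<^sub>k\<close> with \<open>e\<^sub>i - x\<^sub>k\<close> for \<open>i < k\<close> (both negative) and \<open>x\<^bsub>i+1\<^esub> - x\<^sub>k\<close> with \<open>e\<^sub>i - x\<^sub>k\<close> for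
  \<open>i \<ge> k\<close> (both positive).
\<close>

lemma interlacing_prod_pos:
  fixes x e :: "nat \<Rightarrow> real"
  assumes il: "\<And>i. i \<in> {1..m} \<Longrightarrow> x i < e i \<and> e i < x (i + 1)"
    and k: "k \<in> {1..m+1}"
  shows "0 < (\<Prod>i\<in>{1..m+1}-{k}. x i - x k) * (\<Prod>i=1..m. e i - x k)"
proof -
  define \<sigma> where "\<sigma> i = (if i < k then i else i + 1)" for i
  have "bij_betw \<sigma> {1..m} ({1..m+1}-{k})"
    using k by (intro bij_betw_byWitness[where f' = "\<lambda>i. if i < k then i else i - 1"]) (auto simp: \<sigma>_def)
  then have "(\<Prod>i\<in>{1..m+1}-{k}. x i - x k) = (\<Prod>i=1..m. x (\<sigma> i) - x k)"
    by (simp add: prod.reindex_bij_betw[symmetric])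
  moreover have "0 < (x (\<sigma> i) - x k) * (e i - x k)" if i: "i \<in> {1..m}" for i
  proof (cases "i < k")
    case True
    then have "x (i + 1) \<le> x k"
      using k i interlacing_less[of m x e "i+1" k, OF il] by (cases "i + 1 = k") auto
    then show ?thesis using True il[OF i] by (auto simp: \<sigma>_def intro!: mult_neg_neg)
  next
    case False
    then have "x k \<le> x i"
      using k i interlacing_less[of m x e k i, OF il] by (cases "i = k") auto
    then show ?thesis using False il[OF i] by (auto simp: \<sigma>_def intro!: mult_pos_pos)
  qed
  then have "0 < (\<Prod>i=1..m. (x (\<sigma> i) - x k) * (e i - x k))"
    by (rule prod_pos)
  ultimately show ?thesis by (simp only: prod.distrib)
qed

lemma interlacing_inj_on:
  fixes x e :: "nat \<Rightarrow> real"
  assumes il: "\<And>i. i \<in> {1..m} \<Longrightarrow> x i < e i \<and> e i < x (i + 1)"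
  shows "inj_on x {1..m+1}"
proof (rule inj_onI, rule ccontr)
  fix i j assume "i \<in> {1..m+1}" "j \<in> {1..m+1}" "x i = x j" "i \<noteq> j"
  then show False
    using interlacing_less[of m x e i j, OF il] interlacing_less[of m x e j i, OF il]
    by (cases "i < j") auto
qed

lemma interlacing_pos:
  fixes x e :: "nat \<Rightarrow> real"
  assumes il: "\<And>i. i \<in> {1..m} \<Longrightarrow> x i < e i \<and> e i < x (i + 1)"
    and "0 < x 1" "k \<in> {1..m+1}"
  shows "0 < x k"
  using interlacing_less[of m x e 1 k, OF il] assms(2,3) by (cases "k = 1") auto

lemma interlacing_ne:
  fixes x e :: "nat \<Rightarrow> real"
  assumes il: "\<And>i. i \<in> {1..m} \<Longrightarrow> x i < e i \<and> e i < x (i + 1)"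
    and k: "k \<in> {1..m+1}" and i: "i \<in> {1..m}"
  shows "e i \<noteq> x k"
proof (cases "k \<le> i")
  case True
  then have "x k \<le> x i"
    using k i interlacing_less[of m x e k i, OF il] by (cases "k = i") auto
  then show ?thesis using il[OF i] by auto
next
  case False
  then have "x (i + 1) \<le> x k"
    using k i interlacing_less[of m x e "i+1" k, OF il] by (cases "k = i + 1") auto
  then show ?thesis using il[OF i] by auto
qed

section \<open>Partial fractions\<close>

text \<open>
  The numerator of \<open>u + (\<Sum>i\<in>I. x\<^sub>i / L\<^sub>i)\<close> over the common denominator \<open>\<Prod>\<^bsub>i\<in>I\<^esub> L\<^sub>i\<close>, for a polynomial \<open>u\<close>,
  constants \<open>x\<^sub>i\<close> and denominators \<open>L\<^sub>i\<close> that are linear polynomials in all uses below.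
\<close>

definition numerator :: "'i set \<Rightarrow> ('i \<Rightarrow> real poly) \<Rightarrow> real poly \<Rightarrow> ('i \<Rightarrow> real) \<Rightarrow> real poly" where
  "numerator I L u x = u * (\<Prod>i\<in>I. L i) + (\<Sum>i\<in>I. smult (x i) (\<Prod>l\<in>I-{i}. L l))"

lemma poly_numerator:
  assumes "finite I" "\<And>i. i \<in> I \<Longrightarrow> poly (L i) z \<noteq> 0"
  shows "poly (numerator I L u x) z = (\<Prod>i\<in>I. poly (L i) z) * (poly u z + (\<Sum>i\<in>I. x i / poly (L i) z))"
proof -
  have "x i * (\<Prod>l\<in>I-{i}. poly (L l) z) = (\<Prod>l\<in>I. poly (L l) z) * (x i / poly (L i) z)" if "i \<in> I" for i
    using assms that by (simp add: prod.remove[of I i])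
  then show ?thesis
    by (simp add: numerator_def poly_sum poly_prod distrib_left sum_distrib_left mult.commute)
qed

lemma degree_numerator_le:
  assumes "finite I" "\<And>i. i \<in> I \<Longrightarrow> degree (L i) \<le> 1"
  shows "degree (numerator I L u x) \<le> degree u + card I"
proof -
  have deg: "degree (\<Prod>i\<in>A. L i) \<le> card I" if "A \<subseteq> I" for A
  proof -
    have "finite A" using that assms(1) finite_subset by blast
    then have "degree (\<Prod>i\<in>A. L i) \<le> (\<Sum>i\<in>A. degree (L i))"
      using degree_prod_sum_le[of A L] by (simp add: o_def)
    also have "\<dots> \<le> (\<Sum>i\<in>A. 1)" using that assms(2) by (intro sum_mono) auto
    also have "\<dots> \<le> card I" using that assms(1) by (simp add: card_mono)
    finally show ?thesis .
  qed
  have "degree (u * (\<Prod>i\<in>I. L i)) \<le> degree u + card I"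
    using degree_mult_le[of u "\<Prod>i\<in>I. L i"] deg[of I] by simp
  moreover have "degree (smult (x i) (\<Prod>l\<in>I-{i}. L l)) \<le> degree u + card I" for i
    using degree_smult_le[of "x i" "\<Prod>l\<in>I-{i}. L l"] deg[of "I-{i}"] by fastforce
  ultimately show ?thesis
    unfolding numerator_def by (intro degree_add_le degree_sum_le assms(1))
qed

text \<open>
  Uniqueness of partial fraction decompositions: at the zero \<open>w\<^sub>i\<close> of \<open>L\<^sub>i\<close> only the summand of \<open>x\<^sub>i\<close>
  survives.
\<close>

lemma numerator_eq_0:
  assumes "finite I" "numerator I L u x = 0"
    and L_ne: "\<And>i. i \<in> I \<Longrightarrow> L i \<noteq> 0"
    and zero: "\<And>i. i \<in> I \<Longrightarrow> poly (L i) (w i) = 0"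
    and nz: "\<And>i l. i \<in> I \<Longrightarrow> l \<in> I \<Longrightarrow> l \<noteq> i \<Longrightarrow> poly (L l) (w i) \<noteq> 0"
  shows "u = 0" "\<And>i. i \<in> I \<Longrightarrow> x i = 0"
proof -
  have x0: "x i = 0" if i: "i \<in> I" for i
  proof -
    have "poly (numerator I L u x) (w i) = (\<Sum>k\<in>I. x k * (\<Prod>l\<in>I-{k}. poly (L l) (w i)))"
      using assms(1) i zero by (auto simp: numerator_def poly_sum poly_prod)
    also have "\<dots> = (\<Sum>k\<in>I. if k = i then x i * (\<Prod>l\<in>I-{i}. poly (L l) (w i)) else 0)"
      using assms(1) i zero by (intro sum.cong) auto
    also have "\<dots> = x i * (\<Prod>l\<in>I-{i}. poly (L l) (w i))"
      using assms(1) i by simp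
    finally show ?thesis using assms(1,2) nz i by simp
  qed
  show "x i = 0" if "i \<in> I" for i using x0 that .
  then have "u * (\<Prod>i\<in>I. L i) = 0"
    using assms(2) by (simp add: numerator_def)
  then show "u = 0" using L_ne assms(1) by auto
qed

section \<open>Numerators attached to the process\<close>

text \<open>
  The index set of the linear factors \<open>\<eta>\<^sub>i - z\<close> (left summand) and \<open>\<theta>\<^sub>j + z\<close> (right summand).
\<close>

definition pole_index :: "mejd \<Rightarrow> (nat + nat) set" where
  "pole_index P = {1..num_up P} <+> {1..num_down P}"

definition pole_factor :: "mejd \<Rightarrow> nat + nat \<Rightarrow> real poly" where
  "pole_factor P = case_sum (\<lambda>i. [:\<eta> P i, -1:]) (\<lambda>j. [:\<theta> P j, 1:])"

lemma pole_factor_simps [simp]: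
  "pole_factor P (Inl i) = [:\<eta> P i, -1:]" "pole_factor P (Inr j) = [:\<theta> P j, 1:]"
  by (simp_all add: pole_factor_def)

lemma finite_pole_index [simp]: "finite (pole_index P)"
  and card_pole_index [simp]: "card (pole_index P) = num_up P + num_down P"
  by (simp_all add: pole_index_def card_Plus)

text \<open>
  The polynomial \<open>(G - a) Q\<close>, where \<open>Q\<close> is the product of all factors \<open>\<eta>\<^sub>i - z\<close> and \<open>\<theta>\<^sub>j + z\<close>, including
  those at which \<open>G\<close> has no pole because the coefficient vanishes.
\<close>

definition levy_numerator :: "mejd \<Rightarrow> real \<Rightarrow> real poly" where
  "levy_numerator P a = numerator (pole_index P) (pole_factor P)
     [:- jump_rate P - a, drift P, (vol P)\<^sup>2 / 2:]
     (case_sum (\<lambda>i. jump_rate P * prob_up P * wt_up P i * \<eta> P i)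
               (\<lambda>j. jump_rate P * prob_down P * wt_down P j * \<theta> P j))"

text \<open>
  The polynomial \<open>z \<mapsto> Q(z) (v(z) \<bullet> c)\<close>, with the same \<open>Q\<close>.
\<close>

definition vec_numerator :: "mejd \<Rightarrow> real Matrix.vec \<Rightarrow> real poly" where
  "vec_numerator P c = numerator (pole_index P) (pole_factor P) [:c $ 0, c $ 1:]
     (case_sum (\<lambda>i. c $ (1 + i)) (\<lambda>j. c $ (1 + num_up P + j)))"

text \<open>
  The point \<open>z\<close> is no zero of \<open>Q\<close>. This is stronger than being no pole of \<open>G\<close>.
\<close>

definition no_pole :: "mejd \<Rightarrow> real \<Rightarrow> bool" where
  "no_pole P z \<longleftrightarrow> (\<forall>i\<in>{1..num_up P}. \<eta> P i \<noteq> z) \<and> (\<forall>j\<in>{1..num_down P}. \<theta> P j + z \<noteq> 0)"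

lemma pole_factor_ne_0: "no_pole P z \<Longrightarrow> i \<in> pole_index P \<Longrightarrow> poly (pole_factor P i) z \<noteq> 0"
  by (auto simp: no_pole_def pole_index_def)

lemma prod_pole_factor:
  "(\<Prod>i\<in>pole_index P. poly (pole_factor P i) z)
    = (\<Prod>i=1..num_up P. \<eta> P i - z) * (\<Prod>j=1..num_down P. \<theta> P j + z)"
  by (simp add: pole_index_def prod.Plus)

lemma poly_levy_numerator:
  assumes "no_pole P z"
  shows "poly (levy_numerator P a) z
    = (\<Prod>i=1..num_up P. \<eta> P i - z) * (\<Prod>j=1..num_down P. \<theta> P j + z) * (levy_exponent P z - a)"
proof -
  define x where "x = case_sum (\<lambda>i. jump_rate P * prob_up P * wt_up P i * \<eta> P i)
      (\<lambda>j. jump_rate P * prob_down P * wt_down P j * \<theta> P j)"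
  have "(\<Sum>i\<in>pole_index P. x i / poly (pole_factor P i) z)
    = jump_rate P * (prob_up P * (\<Sum>i = 1..num_up P. wt_up P i * \<eta> P i / (\<eta> P i - z))
       + prob_down P * (\<Sum>j = 1..num_down P. wt_down P j * \<theta> P j / (\<theta> P j + z)))"
    by (simp add: pole_index_def sum.Plus x_def distrib_left sum_distrib_left mult.assoc)
  then have "poly [:- jump_rate P - a, drift P, (vol P)\<^sup>2 / 2:] z
      + (\<Sum>i\<in>pole_index P. x i / poly (pole_factor P i) z) = levy_exponent P z - a"
    by (simp add: levy_exponent_def algebra_simps power2_eq_square)
  then show ?thesis
    unfolding levy_numerator_def x_def[symmetric]
    by (subst poly_numerator) (auto simp: prod_pole_factor dest: pole_factor_ne_0[OF assms])
qed

lemma scalar_prod_v_vec: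
  assumes "c \<in> carrier_vec (dim_S P)"
  shows "v_vec P z \<bullet> c = c $ 0 + z * c $ 1 + (\<Sum>i=1..num_up P. c $ (1 + i) / (\<eta> P i - z))
    + (\<Sum>j=1..num_down P. c $ (1 + num_up P + j) / (\<theta> P j + z))"
proof -
  define m n where "m = num_up P" and "n = num_down P"
  have dim: "dim_vec c = m + n + 2" using assms by (simp add: dim_S_def m_def n_def)
  define f where "f k = v_vec P z $ k * c $ k" for k
  have f: "f k = ([1, z] @ map (\<lambda>i. 1 / (\<eta> P i - z)) [1..<m + 1]
      @ map (\<lambda>j. 1 / (\<theta> P j + z)) [1..<n + 1]) ! k * c $ k" for k
    by (simp only: f_def v_vec_def vec_of_list_index m_def n_def)
  have fs: "f 0 = c $ 0" "f 1 = z * c $ 1"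
    by (simp_all add: f)
  have up: "f (1 + i) = c $ (1 + i) / (\<eta> P i - z)" if "i \<in> {1..m}" for i
    using that by (auto simp: f nth_append nth_Cons' simp del: upt_Suc)
  have down: "f (1 + m + j) = c $ (1 + m + j) / (\<theta> P j + z)" if "j \<in> {1..n}" for j
    using that by (auto simp: f nth_append nth_Cons' simp del: upt_Suc)
  have "v_vec P z \<bullet> c = (\<Sum>k<m+n+2. f k)"
    by (simp add: scalar_prod_def dim f_def lessThan_atLeast0)
  also have "\<dots> = f 0 + (f 1 + ((\<Sum>i=1..m. f (1 + i)) + (\<Sum>j=1..n. f (1 + m + j))))"
  proof -
    define A B where "A = (\<lambda>i. 1 + i) ` {1..m}" and "B = (\<lambda>j. 1 + m + j) ` {1..n}"
    have "A = {2..<m+2}" "B = {m+2..<m+n+2}"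
      unfolding A_def B_def using image_add_atLeastAtMost[of 1 1 m] image_add_atLeastAtMost[of "1+m" 1 n]
      by auto
    then have "{..<m+n+2} = insert 0 (insert 1 (A \<union> B))" "0 \<notin> A \<union> B" "1 \<notin> A \<union> B"
        "A \<inter> B = {}" "finite A" "finite B"
      by auto
    then have "(\<Sum>k<m+n+2. f k) = f 0 + (f 1 + (sum f A + sum f B))"
      by (simp add: sum.union_disjoint)
    also have "sum f A = (\<Sum>i=1..m. f (1 + i))"
      unfolding A_def by (subst sum.reindex) (auto simp: inj_on_def)
    also have "sum f B = (\<Sum>j=1..n. f (1 + m + j))"
      unfolding B_def by (subst sum.reindex) (auto simp: inj_on_def)
    finally show ?thesis .
  qed
  finally show ?thesis using fs up down by (simp add: m_def n_def)
qed

lemma poly_vec_numerator: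
  assumes "no_pole P z" "c \<in> carrier_vec (dim_S P)"
  shows "poly (vec_numerator P c) z
    = (\<Prod>i=1..num_up P. \<eta> P i - z) * (\<Prod>j=1..num_down P. \<theta> P j + z) * (v_vec P z \<bullet> c)"
proof -
  define x where "x = case_sum (\<lambda>i. c $ (1 + i)) (\<lambda>j. c $ (1 + num_up P + j))"
  have "poly [:c $ 0, c $ 1:] z + (\<Sum>i\<in>pole_index P. x i / poly (pole_factor P i) z) = v_vec P z \<bullet> c"
    by (simp add: pole_index_def sum.Plus x_def scalar_prod_v_vec[OF assms(2)])
  then show ?thesis
    unfolding vec_numerator_def x_def[symmetric]
    by (subst poly_numerator) (auto simp: prod_pole_factor dest: pole_factor_ne_0[OF assms(1)])
qed

lemma rates_pos:
  assumes "is_mejd P"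
  shows "i \<in> {1..num_up P} \<Longrightarrow> 0 < \<eta> P i" and "j \<in> {1..num_down P} \<Longrightarrow> 0 < \<theta> P j"
  using assms by (auto simp: is_mejd_def)

lemma degree_pole_factor: "i \<in> pole_index P \<Longrightarrow> degree (pole_factor P i) \<le> 1"
  by (cases i) auto

lemma degree_vec_numerator: "degree (vec_numerator P c) < dim_S P"
proof -
  have "degree (vec_numerator P c) \<le> degree [:c $ 0, c $ 1:] + card (pole_index P)"
    unfolding vec_numerator_def by (intro degree_numerator_le degree_pole_factor) auto
  then show ?thesis by (auto simp: dim_S_def split: if_splits)
qed

lemma degree_levy_numerator: "degree (levy_numerator P a) \<le> dim_S P"
proof -
  have "degree (levy_numerator P a)
      \<le> degree [:- jump_rate P - a, drift P, (vol P)\<^sup>2 / 2:] + card (pole_index P)"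
    unfolding levy_numerator_def by (intro degree_numerator_le degree_pole_factor) auto
  then show ?thesis by (auto simp: dim_S_def split: if_splits)
qed

lemma vec_numerator_eq_0:
  assumes "is_mejd P" "c \<in> carrier_vec (dim_S P)" "vec_numerator P c = 0"
  shows "c = 0\<^sub>v (dim_S P)"
proof -
  define w where "w = case_sum (\<eta> P) (\<lambda>j. - \<theta> P j)"
  have inj: "inj_on (\<eta> P) {1..num_up P}" "inj_on (\<theta> P) {1..num_down P}"
    using assms(1) by (auto simp: is_mejd_def intro: strict_mono_on_imp_inj_on)
  have pos: "0 < \<eta> P i" "0 < \<theta> P j" if "i \<in> {1..num_up P}" "j \<in> {1..num_down P}" for i j
    using assms(1) that by (auto simp: is_mejd_def)
  have "poly (pole_factor P i) (w i) = 0" for i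
    by (cases i) (auto simp: w_def)
  moreover have "poly (pole_factor P l) (w i) \<noteq> 0"
    if "i \<in> pole_index P" "l \<in> pole_index P" "l \<noteq> i" for i l
  proof -
    have "\<theta> P j + \<eta> P i \<noteq> 0" if "i \<in> {1..num_up P}" "j \<in> {1..num_down P}" for i j
      using pos[OF that] by linarith
    moreover have "\<eta> P i + \<theta> P j \<noteq> 0" if "i \<in> {1..num_up P}" "j \<in> {1..num_down P}" for i j
      using pos[OF that] by linarith
    moreover have "\<eta> P l \<noteq> \<eta> P i" if "i \<in> {1..num_up P}" "l \<in> {1..num_up P}" "l \<noteq> i" for i l
      using inj(1) that by (metis inj_onD)
    moreover have "\<theta> P l \<noteq> \<theta> P i" if "i \<in> {1..num_down P}" "l \<in> {1..num_down P}" "l \<noteq> i" for i l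
      using inj(2) that by (metis inj_onD)
    ultimately show ?thesis
      using that unfolding pole_index_def by (elim PlusE) (simp_all add: w_def)
  qed
  moreover have "pole_factor P i \<noteq> 0" for i
    by (cases i) auto
  ultimately have *: "[:c $ 0, c $ 1:] = 0"
    "\<And>i. i \<in> pole_index P \<Longrightarrow> case_sum (\<lambda>i. c $ (1 + i)) (\<lambda>j. c $ (1 + num_up P + j)) i = 0"
    using numerator_eq_0[OF finite_pole_index assms(3)[unfolded vec_numerator_def], of w] by auto
  have up: "c $ (1 + i) = 0" if "i \<in> {1..num_up P}" for i
  proof -
    have "Inl i \<in> pole_index P" using that unfolding pole_index_def by (rule InlI)
    from *(2)[OF this] show ?thesis by simp
  qed
  have down: "c $ (1 + num_up P + j) = 0" if "j \<in> {1..num_down P}" for j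
  proof -
    have "Inr j \<in> pole_index P" using that unfolding pole_index_def by (rule InrI)
    from *(2)[OF this] show ?thesis by simp
  qed
  have "c $ k = 0" if k: "k < dim_S P" for k
  proof -
    consider "k = 0" | "k = 1" | i where "k = 1 + i" "i \<in> {1..num_up P}"
      | j where "k = 1 + num_up P + j" "j \<in> {1..num_down P}"
    proof -
      assume H: "k = 0 \<Longrightarrow> thesis" "k = 1 \<Longrightarrow> thesis"
        "\<And>i. k = 1 + i \<Longrightarrow> i \<in> {1..num_up P} \<Longrightarrow> thesis"
        "\<And>j. k = 1 + num_up P + j \<Longrightarrow> j \<in> {1..num_down P} \<Longrightarrow> thesis"
      show thesis
        using H(1,2) H(3)[of "k - 1"] H(4)[of "k - 1 - num_up P"] k by (fastforce simp: dim_S_def)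
    qed
    then show ?thesis
      using *(1) up down by cases auto
  qed
  then show ?thesis using assms(2) by auto
qed

section \<open>Signs at the roots\<close>

lemma root_assumption_roots:
  assumes "is_mejd P" "root_assumption P a b g"
  shows "\<And>k. k \<in> {1..num_up P + 1} \<Longrightarrow> 0 < b k \<and> no_pole P (b k) \<and> levy_exponent P (b k) = a"
    and "\<And>j. j \<in> {1..num_down P + 1} \<Longrightarrow> 0 < g j \<and> no_pole P (- g j) \<and> levy_exponent P (- g j) = a"
    and "inj_on b {1..num_up P + 1}" "inj_on g {1..num_down P + 1}"
proof -
  have ilb: "\<And>i. i \<in> {1..num_up P} \<Longrightarrow> b i < \<eta> P i \<and> \<eta> P i < b (i + 1)" and b1: "0 < b 1"
   and ilg: "\<And>j. j \<in> {1..num_down P} \<Longrightarrow> g j < \<theta> P j \<and> \<theta> P j < g (j + 1)" and g1: "0 < g 1"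
   and sol: "{\<zeta>. \<zeta> \<notin> levy_poles P \<and> levy_exponent P \<zeta> = a} =
       b ` {1..num_up P + 1} \<union> (\<lambda>j. - g j) ` {1..num_down P + 1}"
    using assms(2) by (auto simp: root_assumption_def)
  show "inj_on b {1..num_up P + 1}" "inj_on g {1..num_down P + 1}"
    using interlacing_inj_on[of "num_up P" b "\<eta> P"] interlacing_inj_on[of "num_down P" g "\<theta> P"] ilb ilg
    by blast+
  show "0 < b k \<and> no_pole P (b k) \<and> levy_exponent P (b k) = a" if k: "k \<in> {1..num_up P + 1}" for k
  proof (intro conjI)
    show b: "0 < b k" using interlacing_pos[of "num_up P" b "\<eta> P"] ilb b1 k by blast
    show "no_pole P (b k)"
      unfolding no_pole_def
    proof (intro conjI ballI)
      show "\<eta> P i \<noteq> b k" if "i \<in> {1..num_up P}" for i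
        using interlacing_ne[of "num_up P" b "\<eta> P"] ilb k that by blast
      show "\<theta> P j + b k \<noteq> 0" if "j \<in> {1..num_down P}" for j
        using rates_pos(2)[OF assms(1) that] b by linarith
    qed
    show "levy_exponent P (b k) = a" using sol k by blast
  qed
  show "0 < g j \<and> no_pole P (- g j) \<and> levy_exponent P (- g j) = a" if j: "j \<in> {1..num_down P + 1}" for j
  proof (intro conjI)
    show g: "0 < g j" using interlacing_pos[of "num_down P" g "\<theta> P"] ilg g1 j by blast
    show "no_pole P (- g j)"
      unfolding no_pole_def
    proof (intro conjI ballI)
      show "\<theta> P i + - g j \<noteq> 0" if "i \<in> {1..num_down P}" for i
        using interlacing_ne[of "num_down P" g "\<theta> P" j i] ilg j that by simp
      show "\<eta> P i \<noteq> - g j" if "i \<in> {1..num_up P}" for i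
        using rates_pos(1)[OF assms(1) that] g by linarith
    qed
    show "levy_exponent P (- g j) = a" using sol j by blast
  qed
qed

lemma levy_exponent_0:
  assumes "is_mejd P"
  shows "levy_exponent P 0 = 0"
proof -
  have ne: "\<forall>i\<in>{1..num_up P}. \<eta> P i \<noteq> 0" "\<forall>j\<in>{1..num_down P}. \<theta> P j \<noteq> 0"
    using rates_pos[OF assms] by force+
  have "(\<Sum>i = 1..num_up P. wt_up P i * \<eta> P i / \<eta> P i) = (\<Sum>i = 1..num_up P. wt_up P i)"
    using ne(1) by (intro sum.cong) auto
  moreover have "(\<Sum>j = 1..num_down P. wt_down P j * \<theta> P j / \<theta> P j) = (\<Sum>j = 1..num_down P. wt_down P j)"
    using ne(2) by (intro sum.cong) auto
  ultimately show ?thesis using assms by (simp add: levy_exponent_def is_mejd_def)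
qed

text \<open>
  The sign hypotheses of \<open>null_pair_trivial\<close>, with \<open>b, g\<close> the roots at level \<open>\<alpha>\<close> and \<open>b', g'\<close> those at
  level \<open>\<alpha> + \<rho>\<close>. Strict positivity of \<open>\<alpha>\<close> and of \<open>\<rho>\<close> is needed here.
\<close>

lemma root_product_signs:
  assumes P: "is_mejd P" and pos: "0 < \<alpha>" "0 < \<rho>"
    and bg: "root_assumption P \<alpha> b g" and bg': "root_assumption P (\<alpha> + \<rho>) b' g'"
  defines "K \<equiv> {1..num_up P + 1}" and "J \<equiv> {1..num_down P + 1}"
  shows "k \<in> K \<Longrightarrow> (\<Prod>i\<in>K. b i - b' k) * (\<Prod>i\<in>K-{k}. b' i - b' k) < 0"
    and "j \<in> J \<Longrightarrow> (\<Prod>i\<in>J. g i - g' j) * (\<Prod>i\<in>J-{j}. g' i - g' j) < 0"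
proof -
  note rt = root_assumption_roots[OF P bg, folded K_def J_def]
  note rt' = root_assumption_roots[OF P bg', folded K_def J_def]
  define q t where "q z = (\<Prod>i=1..num_up P. \<eta> P i - z)" and "t z = (\<Prod>j=1..num_down P. \<theta> P j + z)" for z
  have q_pos: "0 < q z" if "z \<le> 0" for z
    unfolding q_def using rates_pos(1)[OF P] that by (intro prod_pos) (smt (verit))
  have t_pos: "0 < t z" if "0 \<le> z" for z
    unfolding t_def using rates_pos(2)[OF P] that by (intro prod_pos) (smt (verit))
  define F where "F = levy_numerator P \<alpha>"
  have F: "poly F z = q z * t z * (levy_exponent P z - \<alpha>)" if "no_pole P z" for z
    using poly_levy_numerator[OF that] by (simp add: F_def q_def t_def)
  obtain c where c: "poly F z = c * ((\<Prod>k\<in>K. b k - z) * (\<Prod>j\<in>J. g j + z))" for z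
  proof -
    have "degree F \<le> card K + card J"
      using degree_levy_numerator[of P \<alpha>] by (simp add: F_def K_def J_def dim_S_def)
    moreover have "finite K" "finite J" "0 < card K + card J" by (simp_all add: K_def J_def)
    moreover have "poly F (b k) = 0" if "k \<in> K" for k using F rt(1)[OF that] by simp
    moreover have "poly F (- g j) = 0" if "j \<in> J" for j using F rt(2)[OF that] by simp
    ultimately have "poly F z = (-1) ^ card K * coeff F (card K + card J)
        * ((\<Prod>k\<in>K. b k - z) * (\<Prod>j\<in>J. g j + z))" for z
      using rt by (intro poly_eq_prod_of_roots) simp_all
    then show thesis by (rule that)
  qed
  have c_neg: "c < 0"
  proof -
    have "no_pole P 0" using rates_pos[OF P] by (force simp: no_pole_def)
    then have "poly F 0 = - (q 0 * t 0 * \<alpha>)"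
      using F levy_exponent_0[OF P] by simp
    also have "\<dots> < 0" using q_pos t_pos pos by simp
    finally have "c * ((\<Prod>k\<in>K. b k) * (\<Prod>j\<in>J. g j)) < 0" by (simp add: c)
    moreover have "0 < (\<Prod>k\<in>K. b k) * (\<Prod>j\<in>J. g j)"
      using rt by (intro mult_pos_pos prod_pos) auto
    ultimately show ?thesis by (smt (verit) mult_nonneg_nonneg)
  qed
  \<comment> \<open>At a root of level \<open>\<alpha> + \<rho>\<close> the polynomial \<open>F\<close> has the value \<open>\<rho> Q T\<close>, with \<open>Q T\<close> the common
    denominator and \<open>T\<close> its positive part; \<open>G\<close> is the positive part of the factored form, and \<open>X\<close> the
    product of root differences, of the same sign as \<open>Q\<close> by interlacing.\<close>
  have neg: "A * X < 0" if "c * (A * G) = \<rho> * (Q * T)" "0 < G" "0 < T" "0 < X * Q" for A X G Q T :: real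
  proof -
    have "0 < \<rho> * T * (X * Q)" using that pos by simp
    also have "\<dots> = X * (c * (A * G))" by (subst that(1)) (simp only: mult_ac)
    also have "\<dots> = (A * X) * (c * G)" by (simp only: mult_ac)
    finally show ?thesis using c_neg \<open>0 < G\<close> by (simp add: zero_less_mult_iff mult_less_0_iff) 
  qed
  show "(\<Prod>i\<in>K. b i - b' k) * (\<Prod>i\<in>K-{k}. b' i - b' k) < 0" if k: "k \<in> K"
  proof (rule neg)
    show "c * ((\<Prod>i\<in>K. b i - b' k) * (\<Prod>j\<in>J. g j + b' k)) = \<rho> * (q (b' k) * t (b' k))"
      using F[of "b' k"] rt'(1)[OF k] by (simp add: c)
    show "0 < (\<Prod>j\<in>J. g j + b' k)"
      using rt(2) rt'(1)[OF k] by (intro prod_pos) (simp add: add_pos_pos)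
    show "0 < t (b' k)" using t_pos rt'(1)[OF k] by simp
    show "0 < (\<Prod>i\<in>K-{k}. b' i - b' k) * q (b' k)"
      unfolding q_def K_def using bg' k
      by (intro interlacing_prod_pos) (auto simp: root_assumption_def K_def)
  qed
  show "(\<Prod>i\<in>J. g i - g' j) * (\<Prod>i\<in>J-{j}. g' i - g' j) < 0" if j: "j \<in> J"
  proof (rule neg)
    show "c * ((\<Prod>i\<in>J. g i - g' j) * (\<Prod>k\<in>K. b k + g' j)) = \<rho> * (t (- g' j) * q (- g' j))"
      using F[of "- g' j"] rt'(2)[OF j] by (simp add: c mult_ac)
    show "0 < (\<Prod>k\<in>K. b k + g' j)"
      using rt(1) rt'(2)[OF j] by (intro prod_pos) (simp add: add_pos_pos)
    show "0 < q (- g' j)" using q_pos rt'(2)[OF j] by simp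
    show "0 < (\<Prod>i\<in>J-{j}. g' i - g' j) * t (- g' j)"
      using interlacing_prod_pos[of "num_down P" g' "\<theta> P" j] bg' j
      by (simp add: t_def root_assumption_def J_def)
  qed
qed

section \<open>The left kernel\<close>

lemma M_mat_carrier: "M_mat P b g' \<in> carrier_mat (dim_S P) (dim_S P)"
  and N_mat_carrier: "N_mat P g b' \<in> carrier_mat (dim_S P) (dim_S P)"
  by (rule carrier_matI; simp add: M_mat_def N_mat_def dim_S_def del: upt_Suc)+

lemma mat_diag_carrier: "mat_diag n f \<in> carrier_mat n n"
  by (simp add: mat_diag_def)

lemma B_mat_carrier:
  "B_mat P h H b g b' g' \<in> carrier_mat (dim_S P + dim_S P) (dim_S P + dim_S P)"
  unfolding B_mat_def Let_def by (intro four_block_carrier_mat M_mat_carrier N_mat_carrier)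

lemma nth_map_upt_append:
  "k \<in> {1..l + 1} \<Longrightarrow> (map f [1..<l + 2] @ ys) ! (k - 1) = f k"
  by (auto simp: nth_append simp del: upt_Suc)

lemma nth_append_map_upt:
  "k \<in> {1..l + 1} \<Longrightarrow> (xs @ map f [1..<l + 2]) ! (length xs + k - 1) = f k"
  by (auto simp: nth_append simp del: upt_Suc)

lemma nth_replicate_append:
  "k \<in> {1..l + 1} \<Longrightarrow> (replicate (l + 1) x @ ys) ! (k - 1) = x"
  by (auto simp: nth_append simp del: replicate_Suc)

text \<open>
  One equation for each column of \<open>B\<close>. The factors \<open>exp\<close> come from the nonzero entries of the two
  diagonal matrices; the zero entries decouple the columns at level \<open>\<alpha>\<close>.
\<close>

lemma B_mat_left_kernel:
  fixes P h H b g b' g' c d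
  defines "S \<equiv> dim_S P"
  assumes c: "c \<in> carrier_vec S" and d: "d \<in> carrier_vec S"
    and ker: "transpose_mat (B_mat P h H b g b' g') *\<^sub>v (c @\<^sub>v d) = 0\<^sub>v (S + S)"
  shows "k \<in> {1..num_up P + 1} \<Longrightarrow> v_vec P (b k) \<bullet> c = 0"
    and "j \<in> {1..num_down P + 1} \<Longrightarrow>
      v_vec P (- g' j) \<bullet> c + exp (g' j * (h - H)) * (v_vec P (- g' j) \<bullet> d) = 0"
    and "j \<in> {1..num_down P + 1} \<Longrightarrow> v_vec P (- g j) \<bullet> d = 0"
    and "k \<in> {1..num_up P + 1} \<Longrightarrow>
      exp (b' k * (h - H)) * (v_vec P (b' k) \<bullet> c) + v_vec P (b' k) \<bullet> d = 0"
proof -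
  define m n where "m = num_up P" and "n = num_down P"
  have S: "S = m + n + 2" by (simp add: S_def dim_S_def m_def n_def)
  have v: "v_vec P z \<in> carrier_vec S" for z
    by (rule carrier_vecI) (simp add: v_vec_def S m_def n_def del: upt_Suc)
  define M N where "M = M_mat P b g'" and "N = N_mat P g b'"
  define zb zg where "zb = nth (replicate (n + 1) 0 @ map (\<lambda>i. exp (b' i * (h - H))) [1..<m + 2])"
    and "zg = nth (replicate (m + 1) 0 @ map (\<lambda>j. exp (g' j * (h - H))) [1..<n + 2])"
  have M: "M \<in> carrier_mat S S" and N: "N \<in> carrier_mat S S"
    unfolding M_def N_def S_def by (rule M_mat_carrier N_mat_carrier)+
  have Z: "Z_beta P h H b' = mat_diag S zb" "Z_gamma P h H g' = mat_diag S zg"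
    by (simp_all add: Z_beta_def Z_gamma_def zb_def zg_def S_def m_def n_def)
  have scaled: "col (A * mat_diag S f) i = f i \<cdot>\<^sub>v col A i" if "A \<in> carrier_mat S S" "i < S" for A :: "real Matrix.mat" and f i
    using that by (intro eq_vecI) (auto simp: mat_diag_mult_right[OF that(1)] mult.commute)
  have carr: "N * mat_diag S zb \<in> carrier_mat S S" "M * mat_diag S zg \<in> carrier_mat S S"
    using M N mat_diag_carrier by (metis mult_carrier_mat)+
  have "B_mat P h H b g b' g' = four_block_mat M (N * mat_diag S zb) (M * mat_diag S zg) N"
    by (simp add: B_mat_def M_def N_def Z Let_def)
  then have "transpose_mat (B_mat P h H b g b' g') *\<^sub>v (c @\<^sub>v d)
    = (transpose_mat M *\<^sub>v c + transpose_mat (M * mat_diag S zg) *\<^sub>v d)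
      @\<^sub>v (transpose_mat (N * mat_diag S zb) *\<^sub>v c + transpose_mat N *\<^sub>v d)" (is "_ = ?l @\<^sub>v ?r")
    using M N carr c d
    by (simp only: transpose_four_block_mat[OF M carr N])
       (rule four_block_mat_mult_vec[where ?nr1.0 = S and ?nc1.0 = S and ?nr2.0 = S and ?nc2.0 = S]; simp)
  then have "?l @\<^sub>v ?r = 0\<^sub>v (S + S)"
    using ker by simp
  also have "(0\<^sub>v (S + S) :: real Matrix.vec) = 0\<^sub>v S @\<^sub>v 0\<^sub>v S" by auto
  finally have "?l = 0\<^sub>v S \<and> ?r = 0\<^sub>v S"
    using M carr c d
    by (subst (asm) append_vec_eq[of _ S])
       (auto intro!: add_carrier_vec mult_mat_vec_carrier[of _ S S])
  then have l: "?l $ i = 0" and r: "?r $ i = 0" if "i < S" for i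
    using that by simp_all
  have entry: "(transpose_mat A *\<^sub>v x + transpose_mat A' *\<^sub>v y) $ i = col A i \<bullet> x + col A' i \<bullet> y"
    if "A \<in> carrier_mat S S" "A' \<in> carrier_mat S S" "i < S" for A A' :: "real Matrix.mat" and x y i
    using that by simp
  have L: "col M i \<bullet> c + zg i * (col M i \<bullet> d) = 0" if "i < S" for i
    using l[OF that, unfolded entry[OF M carr(2) that] scaled[OF M that]] M d by simp
  have R: "zb i * (col N i \<bullet> c) + col N i \<bullet> d = 0" if "i < S" for i
    using r[OF that, unfolded entry[OF carr(1) N that] scaled[OF N that]] N c by simp
  define Ms Ns where "Ms = map (\<lambda>i. v_vec P (b i)) [1..<m + 2] @ map (\<lambda>j. v_vec P (- g' j)) [1..<n + 2]"
    and "Ns = map (\<lambda>j. v_vec P (- g j)) [1..<n + 2] @ map (\<lambda>i. v_vec P (b' i)) [1..<m + 2]"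
  have len: "length Ms = S" "length Ns = S" by (simp_all add: Ms_def Ns_def S)
  have in_carrier: "set Ms \<subseteq> carrier_vec S" "set Ns \<subseteq> carrier_vec S"
    using v by (auto simp: Ms_def Ns_def)
  have col: "col M i = Ms ! i" "col N i = Ns ! i" if "i < S" for i
    unfolding M_def N_def M_mat_def N_mat_def S_def[symmetric] m_def[symmetric] n_def[symmetric]
      Ms_def[symmetric] Ns_def[symmetric]
    using that len in_carrier nth_mem by (auto intro!: col_mat_of_cols)
  have colM: "col M (k - 1) = v_vec P (b k)" "zg (k - 1) = 0" and
       colN: "col N (n + k) = v_vec P (b' k)" "zb (n + k) = exp (b' k * (h - H))"
    if k: "k \<in> {1..m + 1}" for k
  proof -
    have "k - 1 < S" "n + k < S" using k by (auto simp: S)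
    then show "col M (k - 1) = v_vec P (b k)" "col N (n + k) = v_vec P (b' k)"
      using nth_map_upt_append[OF k] nth_append_map_upt[OF k, where xs = "map (\<lambda>j. v_vec P (- g j)) [1..<n + 2]"]
      by (simp_all add: col Ms_def Ns_def del: upt_Suc)
    show "zg (k - 1) = 0" unfolding zg_def by (rule nth_replicate_append[OF k])
    show "zb (n + k) = exp (b' k * (h - H))"
      using nth_append_map_upt[OF k, where xs = "replicate (n + 1) 0"] by (simp add: zb_def del: upt_Suc replicate_Suc)
  qed
  show "v_vec P (b k) \<bullet> c = 0" if "k \<in> {1..num_up P + 1}"
    using L[of "k - 1"] colM[of k] that by (auto simp: m_def S)
  show "exp (b' k * (h - H)) * (v_vec P (b' k) \<bullet> c) + v_vec P (b' k) \<bullet> d = 0"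
    if "k \<in> {1..num_up P + 1}"
    using R[of "n + k"] colN[of k] that by (auto simp: m_def S)
  have colM': "col M (m + j) = v_vec P (- g' j)" "zg (m + j) = exp (g' j * (h - H))" and
       colN': "col N (j - 1) = v_vec P (- g j)" "zb (j - 1) = 0"
    if j: "j \<in> {1..n + 1}" for j
  proof -
    have "j - 1 < S" "m + j < S" using j by (auto simp: S)
    then show "col M (m + j) = v_vec P (- g' j)" "col N (j - 1) = v_vec P (- g j)"
      using nth_map_upt_append[OF j] nth_append_map_upt[OF j, where xs = "map (\<lambda>i. v_vec P (b i)) [1..<m + 2]"]
      by (simp_all add: col Ms_def Ns_def del: upt_Suc)
    show "zb (j - 1) = 0" unfolding zb_def by (rule nth_replicate_append[OF j])
    show "zg (m + j) = exp (g' j * (h - H))"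
      using nth_append_map_upt[OF j, where xs = "replicate (m + 1) 0"] by (simp add: zg_def del: upt_Suc replicate_Suc)
  qed
  show "v_vec P (- g' j) \<bullet> c + exp (g' j * (h - H)) * (v_vec P (- g' j) \<bullet> d) = 0"
    if "j \<in> {1..num_down P + 1}"
    using L[of "m + j"] colM'[of j] that by (auto simp: n_def S)
  show "v_vec P (- g j) \<bullet> d = 0" if "j \<in> {1..num_down P + 1}"
    using R[of "j - 1"] colN'[of j] that by (auto simp: n_def S)
qed

lemma invertible_mat_if_left_kernel_trivial:
  fixes A :: "'a :: field Matrix.mat"
  assumes A: "A \<in> carrier_mat n n"
    and ker: "\<And>v. v \<in> carrier_vec n \<Longrightarrow> transpose_mat A *\<^sub>v v = 0\<^sub>v n \<Longrightarrow> v = 0\<^sub>v n"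
  shows "invertible_mat A"
proof -
  have "Determinant.det (transpose_mat A) \<noteq> 0"
    using det_0_iff_vec_prod_zero_field[of "transpose_mat A" n] A ker by auto
  then have "Determinant.det A \<noteq> 0" using det_transpose[OF A] by simp
  then obtain B where "B \<in> carrier_mat n n" "A * B = 1\<^sub>m n" "B * A = 1\<^sub>m n"
    using det_non_zero_imp_unit[OF A, of "()"] by (auto simp: Units_def ring_mat_def)
  then show ?thesis
    using A by (auto simp: invertible_mat_def inverts_mat_def)
qed

theorem lemma3p1:
  fixes P :: mejd and h H \<alpha> \<rho> :: real
    and \<beta> \<gamma> :: "real \<Rightarrow> nat \<Rightarrow> real"
  assumes "is_mejd P"
    and "h < H" and "\<alpha> > 0" and "\<rho> > 0"
    and "root_assumption P \<alpha> (\<beta> \<alpha>) (\<gamma> \<alpha>)"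
    and "root_assumption P (\<alpha> + \<rho>) (\<beta> (\<alpha> + \<rho>)) (\<gamma> (\<alpha> + \<rho>))"
  shows "invertible_mat (B_mat P h H (\<beta> \<alpha>) (\<gamma> \<alpha>) (\<beta> (\<alpha> + \<rho>)) (\<gamma> (\<alpha> + \<rho>)))"
proof (rule invertible_mat_if_left_kernel_trivial)
  define S where "S = dim_S P"
  define b g b' g' where "b = \<beta> \<alpha>" and "g = \<gamma> \<alpha>" and "b' = \<beta> (\<alpha> + \<rho>)" and "g' = \<gamma> (\<alpha> + \<rho>)"
  note defs = b_def g_def b'_def g'_def
  show "B_mat P h H (\<beta> \<alpha>) (\<gamma> \<alpha>) (\<beta> (\<alpha> + \<rho>)) (\<gamma> (\<alpha> + \<rho>)) \<in> carrier_mat (S + S) (S + S)"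
    unfolding S_def by (rule B_mat_carrier)
  fix v :: "real Matrix.vec"
  assume v: "v \<in> carrier_vec (S + S)"
    and ker: "transpose_mat (B_mat P h H (\<beta> \<alpha>) (\<gamma> \<alpha>) (\<beta> (\<alpha> + \<rho>)) (\<gamma> (\<alpha> + \<rho>))) *\<^sub>v v = 0\<^sub>v (S + S)"
  define c d where "c = vec_first v S" and "d = vec_last v S"
  have cd: "c \<in> carrier_vec S" "d \<in> carrier_vec S" "v = c @\<^sub>v d"
    using v by (simp_all add: c_def d_def)
  note kernel = B_mat_left_kernel[OF cd(1,2)[unfolded S_def] ker[unfolded cd(3) S_def, folded defs]]
  define K J where "K = {1..num_up P + 1}" and "J = {1..num_down P + 1}"
  note rt = root_assumption_roots[OF assms(1,5), folded defs K_def J_def]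
  note rt' = root_assumption_roots[OF assms(1,6), folded defs K_def J_def]
  define Q where "Q z = (\<Prod>i=1..num_up P. \<eta> P i - z) * (\<Prod>j=1..num_down P. \<theta> P j + z)" for z
  define p r where "p = vec_numerator P c" and "r = vec_numerator P d"
  have p: "poly p z = Q z * (v_vec P z \<bullet> c)" and r: "poly r z = Q z * (v_vec P z \<bullet> d)" if "no_pole P z" for z
    using poly_vec_numerator[OF that] cd by (simp_all add: p_def r_def Q_def S_def)
  have le: "\<bar>Q z * x\<bar> \<le> \<bar>Q z * y\<bar>" if "x + exp (s * (h - H)) * y = 0" "0 < s" for x y z s
  proof -
    have "\<bar>x\<bar> = exp (s * (h - H)) * \<bar>y\<bar>"
      using that(1) by (simp add: eq_neg_iff_add_eq_0[symmetric] abs_mult)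
    also have "\<dots> \<le> 1 * \<bar>y\<bar>"
      using that(2) assms(2) by (intro mult_right_mono) (auto simp: mult_le_0_iff)
    finally show ?thesis by (simp add: abs_mult mult_left_mono)
  qed
  have "p = 0 \<and> r = 0"
  proof (rule null_pair_trivial[of K J b b' g g'])
    show "(\<Prod>i\<in>K. b i - b' k) * (\<Prod>i\<in>K-{k}. b' i - b' k) < 0" if "k \<in> K" for k
      using root_product_signs(1)[OF assms(1,3-6), of k] that by (simp add: K_def defs)
    show "(\<Prod>i\<in>J. g i - g' j) * (\<Prod>i\<in>J-{j}. g' i - g' j) < 0" if "j \<in> J" for j
      using root_product_signs(2)[OF assms(1,3-6), of j] that by (simp add: J_def defs)
    have "dim_S P = card K + card J" by (simp add: K_def J_def dim_S_def)
    then show "degree p < card K + card J" "degree r < card K + card J"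
      using degree_vec_numerator[of P c] degree_vec_numerator[of P d] by (simp_all add: p_def r_def)
    show "poly p (b k) = 0" if "k \<in> K" for k
      using p rt(1)[OF that] kernel(1) that by (simp add: K_def)
    show "poly r (- g j) = 0" if "j \<in> J" for j
      using r rt(2)[OF that] kernel(3) that by (simp add: J_def)
    show "\<bar>poly p (- g' j)\<bar> \<le> \<bar>poly r (- g' j)\<bar>" if "j \<in> J" for j
      using le[OF kernel(2)] rt'(2)[OF that] that by (simp add: p r J_def)
    show "\<bar>poly r (b' k)\<bar> \<le> \<bar>poly p (b' k)\<bar>" if "k \<in> K" for k
      using le[of "v_vec P (b' k) \<bullet> d" "b' k" "v_vec P (b' k) \<bullet> c" "b' k"] kernel(4)[of k] rt'(1)[OF that] that
      by (simp add: p r K_def add.commute)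
  qed (use rt rt' in \<open>auto simp: K_def J_def\<close>)
  then have "c = 0\<^sub>v S" "d = 0\<^sub>v S"
    using vec_numerator_eq_0[OF assms(1), of c] vec_numerator_eq_0[OF assms(1), of d] cd
    unfolding p_def r_def S_def by auto
  then show "v = 0\<^sub>v (S + S)" using cd(3) by auto
qed

end
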